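(* Let $s,p\in\mathbb{N}$. For all $n\in\mathbb{N}'$, the partial derivatives of bivariate $s$-Fibopolynomials satisfy $$\frac{\partial}{\partial x}\binom{n}{p}_{F_s}=s\binom{n}{p}_{F_s}\ast\sum_{k=0}^{\lfloor (p+1)/2\rfloor-1}(p-2k)(-y)^{skn}F_{s(p-2k)n}$$ and $$\frac{\partial}{\partial y}\binom{n+1}{p}_{F_s}=sp\binom{n}{p}_{F_s}\ast\left(\sum_{k=0}^{\lfloor (p+1)/2\rfloor-1}(-y)^{sk(n+1)}\left(F_{s(p-2k)(n+1)-1}+\frac{kx}{py}F_{s(p-2k)(n+1)}\right)-\frac{1+(-1)^p}{4}(-y)^{\frac{sp}{2}(n+1)-1}\right),$$ where $\ast$ is convolution of sequences indexed by $n\ge0$.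
   Context: $\mathbb{N}=\{1,2,\dots\}$, $\mathbb{N}'=\mathbb{N}\cup\{0\}$. $x,y$ are indeterminates and we abbreviate $F_n=F_n(x,y)$. The bivariate Fibonacci polynomials are $F_0=0$, $F_1=1$, $F_{n+2}=xF_{n+1}+yF_n$. For $n,k\in\mathbb{N}'$ the bivariate $s$-Fibopolynomial (a polynomial in $x,y$) is $\binom{n}{k}_{F_s}=\frac{F_{sn}F_{s(n-1)}\cdots F_{s(n-k+1)}}{F_sF_{2s}\cdots F_{ks}}$ (equal to $1$ for $k=0$ and $k=n$, and to $0$ if $k>n$). Convolution: $a_n\ast b_n=\sum_{t=0}^na_tb_{n-t}$, where $a_n$, $b_n$ denote whole sequences in $n$. When $p$ is odd the last term, containing $\frac{1+(-1)^p}{4}$, is $0$. *)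

theory Defs
  imports "HOL-Computational_Algebra.Computational_Algebra"
begin

text \<open>
  Polynomials in \<open>x, y\<close> over a field are represented by the type \<open>'a poly poly\<close>: the outer
  indeterminate is \<open>y\<close>, and the coefficients are polynomials in \<open>x\<close>.
\<close>

definition var_x :: "'a::comm_ring_1 poly poly" where
  "var_x = [:[:0, 1:]:]"

definition var_y :: "'a::comm_ring_1 poly poly" where
  "var_y = [:0, 1:]"

definition partial_x :: "'a::field poly poly \<Rightarrow> 'a poly poly" where
  "partial_x = map_poly pderiv"

definition partial_y :: "'a::field poly poly \<Rightarrow> 'a poly poly" where
  "partial_y = pderiv"

fun bfib :: "nat \<Rightarrow> 'a::comm_ring_1 poly poly" where
  "bfib 0 = 0"
| "bfib (Suc 0) = 1"
| "bfib (Suc (Suc n)) = var_x * bfib (Suc n) + var_y * bfib n"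

text \<open>
  The operation \<open>div\<close> on \<open>'a poly poly\<close> is exact division of polynomials. For \<open>s \<ge> 1\<close> the
  denominator is nonzero and divides the numerator, see \<open>fibopoly_mult_denominator\<close> and
  \<open>to_fract_fibopoly\<close> below. For \<open>k > n\<close> the numerator contains the factor
  \<open>bfib 0 = 0\<close>, so the truncated subtraction does no harm.
\<close>

definition fibopoly :: "nat \<Rightarrow> nat \<Rightarrow> nat \<Rightarrow> 'a::field poly poly" where
  "fibopoly s n k = (\<Prod>i<k. bfib (s * (n - i))) div (\<Prod>i=1..k. bfib (i * s))"

definition convolution :: "(nat \<Rightarrow> 'b::comm_semiring_0) \<Rightarrow> (nat \<Rightarrow> 'b) \<Rightarrow> nat \<Rightarrow> 'b"
    (infixl "\<star>" 70) where
  "(a \<star> b) n = (\<Sum>t=0..n. a t * b (n - t))"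

lemma bfib_add:
  "bfib (m + Suc n) = (bfib (Suc m) * bfib (Suc n) + var_y * bfib m * bfib n
    :: 'a::comm_ring_1 poly poly)"
proof (induction m rule: bfib.induct)
  case (3 m)
  have "bfib (Suc (Suc m) + Suc n)
      = (var_x * bfib (Suc m + Suc n) + var_y * bfib (m + Suc n) :: 'a poly poly)"
    by simp
  also have "\<dots> = bfib (Suc (Suc (Suc m))) * bfib (Suc n) + var_y * bfib (Suc (Suc m)) * bfib n"
    unfolding 3 bfib.simps(3)[of "Suc m"] by (simp add: algebra_simps)
  finally show ?case .
qed simp_all

lemma bfib_nonzero:
  assumes "n > 0"
  shows "bfib n \<noteq> (0 :: 'a::idom poly poly)"
proof -
  have "poly (bfib (Suc m)) 0 = ([:0, 1:] :: 'a poly) ^ m" for m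
    by (induction m) (simp_all add: var_x_def var_y_def)
  then have "poly (bfib n) (0 :: 'a poly) \<noteq> 0"
    using assms by (cases n) simp_all
  then show ?thesis by auto
qed

lemma fibopoly_denominator_dvd:
  "(\<Prod>i=1..k. bfib (i * s)) dvd (\<Prod>i<k. bfib (s * (n - i)) :: 'a::idom poly poly)"
proof (induction n arbitrary: k)
  case 0
  show ?case by (cases k) (simp_all add: lessThan_Suc)
next
  case (Suc n)
  let ?N = "\<lambda>n k. \<Prod>i<k. bfib (s * (n - i)) :: 'a poly poly"
  let ?D = "\<lambda>k. \<Prod>i=1..k. bfib (i * s) :: 'a poly poly"
  show ?case
  proof (cases k)
    case 0
    then show ?thesis by simp
  next
    case k: (Suc j)
    have N: "?N (Suc n) (Suc j) = bfib (s * Suc n) * ?N n j"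
      by (simp add: prod.lessThan_Suc_shift del: prod.lessThan_Suc)
    have N': "?N n (Suc j) = bfib (s * (n - j)) * ?N n j" for n
      by (simp add: mult.commute)
    have D: "?D (Suc j) = bfib (s * Suc j) * ?D j"
      by (simp add: mult.commute)
    show ?thesis
    proof (cases "s = 0 \<or> n < j")
      case True
      then have "?N (Suc n) k = 0"
        unfolding k by (auto intro!: bexI[of _ "Suc n"])
      then show ?thesis by (simp only: dvd_0_right)
    next
      case False
      then obtain r where r: "s * Suc j = Suc r"
        by (cases "s * Suc j") auto
      have "s * Suc n = s * (n - j) + Suc r"
        using False unfolding r[symmetric] by (simp add: algebra_simps flip: distrib_left)
      then have "bfib (s * Suc n) = (bfib (Suc (s * (n - j))) * bfib (s * Suc j)
          + var_y * bfib (s * (n - j)) * bfib r :: 'a poly poly)"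
        by (simp only: bfib_add r)
      then have "?N (Suc n) k = bfib (Suc (s * (n - j))) * (bfib (s * Suc j) * ?N n j)
          + var_y * bfib r * ?N n (Suc j)"
        unfolding k N N' by (simp only: algebra_simps)
      moreover have "?D k dvd bfib (s * Suc j) * ?N n j"
        unfolding k D by (intro mult_dvd_mono dvd_refl Suc.IH)
      moreover have "?D k dvd ?N n (Suc j)"
        unfolding k by (rule Suc.IH)
      ultimately show ?thesis
        by (metis dvd_add dvd_mult)
    qed
  qed
qed

lemma fibopoly_mult_denominator:
  "fibopoly s n k * (\<Prod>i=1..k. bfib (i * s)) = (\<Prod>i<k. bfib (s * (n - i)))"
  unfolding fibopoly_def by (rule dvd_div_mult_self[OF fibopoly_denominator_dvd])

lemma to_fract_fibopoly:
  assumes "s > 0"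
  shows "to_fract (fibopoly s n k :: 'a::field poly poly)
    = to_fract (\<Prod>i<k. bfib (s * (n - i))) / to_fract (\<Prod>i=1..k. bfib (i * s))"
proof -
  have "(\<Prod>i=1..k. bfib (i * s)) \<noteq> (0 :: 'a poly poly)"
    using assms by (simp add: bfib_nonzero)
  then show ?thesis
    by (subst fibopoly_mult_denominator[symmetric]) (simp add: to_fract_mult)
qed

end

theory Submission
  imports Defs
begin

text \<open>
  Write \<open>x = \<alpha> + \<beta>\<close> and \<open>y = - \<alpha> \<beta>\<close>. By Binet's formula, the generating function in \<open>n\<close> of the
  Fibopolynomials with lower index \<open>p\<close> is \<open>z\<^sup>p\<close> divided by the product over \<open>j \<le> p\<close> of
  \<open>1 - r\<^sub>j z\<close>, where \<open>r\<^sub>j = \<alpha>\<^bsup>sj\<^esup> \<beta>\<^bsup>s(p-j)\<^esup>\<close>. Hence a derivation acts on it as multiplication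
  by the sum of the series \<open>D r\<^sub>j z / (1 - r\<^sub>j z)\<close>, which is the convolution. Pairing \<open>j\<close> with
  \<open>p - j\<close> turns the powers of \<open>\<alpha>\<close> and \<open>\<beta>\<close> back into Fibonacci polynomials; for even \<open>p\<close>
  the unpaired \<open>j = p/2\<close> contributes only to the derivative in \<open>y\<close>.
\<close>

section \<open>Logarithmic derivatives of power series\<close>

text \<open>\<open>D\<close> is additive, so it passes through the finite Cauchy product in each
  coefficient. Applying it coefficientwise is thus again a derivation, now on power series.\<close>

lemma fps_map_mult_of_derivation:
  fixes D :: "'a::comm_ring_1 \<Rightarrow> 'a"
  assumes add: "\<And>f g. D (f + g) = D f + D g"
    and mult: "\<And>f g. D (f * g) = D f * g + f * D g"
  shows "Abs_fps (\<lambda>n. D ((F * G) $ n)) =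
    Abs_fps (\<lambda>n. D (F $ n)) * G + F * Abs_fps (\<lambda>n. D (G $ n))"
proof (rule fps_ext)
  fix n
  have "D 0 = 0"
    using add[of 0 0] by simp
  then have "D (sum h A) = (\<Sum>i\<in>A. D (h i))" for h :: "nat \<Rightarrow> 'a" and A
    by (induction A rule: infinite_finite_induct) (simp_all add: add)
  then show "Abs_fps (\<lambda>n. D ((F * G) $ n)) $ n =
      (Abs_fps (\<lambda>n. D (F $ n)) * G + F * Abs_fps (\<lambda>n. D (G $ n))) $ n"
    by (simp add: fps_mult_nth mult sum.distrib)
qed

text \<open>Logarithmic differentiation: the extended derivation kills \<open>fps_X ^ p\<close>, so
  \<open>D G / G\<close> is minus the sum of \<open>D (Q j) / Q j\<close> over the factors
  \<open>Q j\<close> of the product. The assumption on \<open>D (r j)\<close> makes each such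
  quotient a geometric series without divisions.\<close>

lemma derivation_fps_nth_of_mult_prod_eq_X_power:
  fixes D :: "'a::idom \<Rightarrow> 'a" and r c :: "'i \<Rightarrow> 'a"
  assumes add: "\<And>f g. D (f + g) = D f + D g"
    and mult: "\<And>f g. D (f * g) = D f * g + f * D g"
    and r: "\<And>j. j \<in> J \<Longrightarrow> D (r j) = c j * r j"
    and G: "G * (\<Prod>j\<in>J. 1 - fps_const (r j) * fps_X) = fps_X ^ p"
  shows "D (G $ n) = (\<Sum>t<n. G $ t * (\<Sum>j\<in>J. c j * r j ^ (n - t)))"
proof -
  define DF where "DF = (\<lambda>F. Abs_fps (\<lambda>n. D (F $ n)))"
  define Q where "Q = (\<lambda>j. 1 - fps_const (r j) * fps_X)"
  \<comment> \<open>\<open>L j\<close> is the series \<open>c j * r j * X / (1 - r j * X)\<close>.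
    Its constant term is 0, which is why the final sum stops at \<open>t < n\<close>.\<close>
  define L where "L = (\<lambda>j. Abs_fps (\<lambda>m. if m = 0 then 0 else c j * r j ^ m))"
  have DF_mult: "DF (F * H) = DF F * H + F * DF H" for F H
    unfolding DF_def by (rule fps_map_mult_of_derivation[OF add mult])
  have D0: "D 0 = 0" using add[of 0 0] by (metis add_cancel_left_right add_0)
  have D1: "D 1 = 0" using mult[of 1 1] by (metis add_cancel_left_right mult_1 mult_1_right)
  have Dminus: "D (- f) = - D f" for f
    using add[of f "- f"] D0 by (simp add: eq_neg_iff_add_eq_0 add.commute)
  have DF1: "DF 1 = 0"
    by (rule fps_ext) (simp add: DF_def D0 D1)
  have DFX: "DF (fps_X ^ p) = 0"
    by (rule fps_ext) (simp add: DF_def D0 D1 fps_X_power_iff)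
  have DFQ: "DF (Q j) = - (Q j * L j)" if "j \<in> J" for j
  proof (rule fps_ext)
    fix n
    show "DF (Q j) $ n = (- (Q j * L j)) $ n"
    proof (cases n)
      case 0
      then show ?thesis by (simp add: DF_def Q_def L_def D1)
    next
      case (Suc m)
      have "(Q j * L j) $ n = L j $ n - r j * L j $ (n - 1)"
        using Suc by (simp add: Q_def left_diff_distrib mult.assoc)
      also have "\<dots> = (if n = 1 then c j * r j else 0)"
        using Suc by (cases m) (simp_all add: L_def)
      finally show ?thesis
        using Suc r[OF that] by (simp add: DF_def Q_def Dminus D0)
    qed
  qed
  have DFP: "DF (prod Q A) = - (prod Q A * sum L A)" if "A \<subseteq> J" for A
    using that
  proof (induction A rule: infinite_finite_induct)
    case (insert j A)
    then show ?case
      by (simp add: DF_mult DFQ algebra_simps)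
  qed (simp_all add: DF1)
  have P0: "prod Q J \<noteq> 0"
  proof -
    have "prod Q J $ 0 = (\<Prod>j\<in>J. Q j $ 0)"
      by (induction J rule: infinite_finite_induct) simp_all
    also have "\<dots> = 1" by (simp add: Q_def)
    finally show ?thesis by auto
  qed
  have "DF G * prod Q J - G * (prod Q J * sum L J) = DF (G * prod Q J)"
    by (simp add: DF_mult DFP)
  also have "\<dots> = 0" using G DFX by (simp add: Q_def)
  finally have "DF G * prod Q J = (G * sum L J) * prod Q J"
    by (simp add: algebra_simps)
  then have "DF G = G * sum L J"
    using P0 by (metis mult_right_cancel)
  then have "D (G $ n) = (G * sum L J) $ n"
    by (simp add: DF_def fps_eq_iff)
  also have "\<dots> = (\<Sum>t=0..n. G $ t * (\<Sum>j\<in>J. L j $ (n - t)))"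
    by (simp add: fps_mult_nth fps_sum_nth)
  also have "\<dots> = (\<Sum>t<n. G $ t * (\<Sum>j\<in>J. L j $ (n - t)))"
    by (rule sum.mono_neutral_right) (auto simp: L_def)
  also have "\<dots> = (\<Sum>t<n. G $ t * (\<Sum>j\<in>J. c j * r j ^ (n - t)))"
    by (intro sum.cong refl arg_cong2[where f="(*)"]) (simp add: L_def)
  finally show ?thesis .
qed

section \<open>Splitting the characteristic polynomial\<close>

text \<open>
  The target of \<open>embed\<close> has indeterminates \<open>x\<close> (inner) and \<open>\<alpha>\<close> (outer, in place of \<open>y\<close>), with
  \<open>\<beta> = x - \<alpha>\<close>. So \<open>embed\<close> substitutes the nonconstant polynomial \<open>\<alpha>\<^sup>2 - x \<alpha>\<close> for \<open>y\<close> and is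
  therefore injective.
\<close>

definition alpha :: "'a::comm_ring_1 poly poly" where
  "alpha = [:0, 1:]"

definition beta :: "'a::comm_ring_1 poly poly" where
  "beta = [:[:0, 1:], -1:]"

definition embed :: "'a::comm_ring_1 poly poly \<Rightarrow> 'a poly poly" where
  "embed f = pcompose f (- (alpha * beta))"

lemma embed_simps:
  "embed 0 = 0" "embed 1 = 1"
  "embed (f + g) = embed f + embed g" "embed (- f) = - embed f"
  "embed (f * g) = embed f * embed g"
  "embed (sum h A) = (\<Sum>i\<in>A. embed (h i))"
  "embed (prod h A) = (\<Prod>i\<in>A. embed (h i))"
  by (simp_all add: embed_def pcompose_1 pcompose_add pcompose_uminus pcompose_mult
      pcompose_sum pcompose_prod)

lemma embed_power: "embed (f ^ n) = embed f ^ n"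
  by (induction n) (simp_all add: embed_simps)

lemma embed_of_nat: "embed (of_nat n) = of_nat n"
  by (induction n) (simp_all add: embed_simps)

lemma embed_var_x: "embed var_x = alpha + beta"
  by (simp add: embed_def var_x_def alpha_def beta_def)

lemma embed_var_y: "embed var_y = - (alpha * beta)"
  by (simp add: embed_def var_y_def pcompose_pCons)

lemma embed_eq_0_iff: "embed f = 0 \<longleftrightarrow> (f :: 'a::idom poly poly) = 0"
proof -
  have "degree (- (alpha * beta :: 'a poly poly)) > 0"
    by (simp add: alpha_def beta_def)
  then show ?thesis
    using pcompose_eq_0[of f "- (alpha * beta)"] by (auto simp: embed_def)
qed

lemma embed_eq_iff: "embed f = embed g \<longleftrightarrow> (f :: 'a::idom poly poly) = g"
  using embed_eq_0_iff[of "f - g"] by (simp add: embed_def pcompose_diff)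

lemma alpha_neq_beta: "alpha - beta \<noteq> (0 :: 'a::{comm_ring_1,ring_char_0} poly poly)"
proof -
  have "coeff (alpha - beta) 1 = (2 :: 'a poly)"
    by (simp add: alpha_def beta_def)
  then show ?thesis by auto
qed

text \<open>\<open>alpha\<close> and \<open>beta\<close> are the roots of T^2 - x T - y after
  substitution, so their powers obey the Fibonacci recurrence. The factor
  \<open>alpha - beta\<close> stays on the left to remain among polynomials.\<close>

lemma binet: "(alpha - beta) * embed (bfib n) = (alpha ^ n - beta ^ n :: 'a::comm_ring_1 poly poly)"
proof (induction n rule: bfib.induct)
  case (3 n)
  have "(alpha - beta) * embed (bfib (Suc (Suc n)) :: 'a poly poly) =
      (alpha + beta) * ((alpha - beta) * embed (bfib (Suc n)))
      - alpha * beta * ((alpha - beta) * embed (bfib n))"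
    by (simp add: embed_simps embed_var_x embed_var_y algebra_simps)
  also have "\<dots> = alpha ^ Suc (Suc n) - beta ^ Suc (Suc n)"
    unfolding 3 by (simp add: algebra_simps)
  finally show ?case .
qed (simp_all add: embed_simps)

section \<open>Generating function of the Fibopolynomials\<close>

lemma fibopoly_self:
  assumes "s \<ge> 1"
  shows "fibopoly s n n = (1 :: 'a::field poly poly)"
proof -
  have "(\<Prod>i<n. bfib (s * (n - i))) = (\<Prod>i=1..n. bfib (i * s) :: 'a poly poly)"
    by (rule prod.reindex_bij_witness[of _ "\<lambda>i. n - i" "\<lambda>i. n - i"])
      (auto simp: mult.commute)
  moreover have "(\<Prod>i=1..n. bfib (i * s)) \<noteq> (0 :: 'a poly poly)"
    using assms by (simp add: bfib_nonzero)
  ultimately show ?thesis by (simp add: fibopoly_def)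
qed

lemma fibopoly_eq_0:
  assumes "n < k"
  shows "fibopoly s n k = (0 :: 'a::field poly poly)"
proof -
  have "(\<Prod>i<k. bfib (s * (n - i))) = (0 :: 'a poly poly)"
    using assms by (intro prod_zero) (auto intro!: bexI[of _ n])
  then show ?thesis unfolding fibopoly_def by (simp only: div_0)
qed

lemma fibopoly_0_right: "fibopoly s n 0 = (1 :: 'a::field poly poly)"
  by (simp add: fibopoly_def)

text \<open>An analogue of Pascal's rule. Binet's formula splits F_{s(m+k+1)} as alpha^{s(k+1)}
  F_{sm} + beta^{sm} F_{s(k+1)}; multiplying by the common part of the numerators gives the claim
  over the denominator of order k+1. Writing the upper index as \<open>m + k\<close> avoids a
  subtraction in the exponent.\<close>

lemma embed_fibopoly_Suc_Suc:
  assumes "s \<ge> 1"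
  shows "embed (fibopoly s (Suc (m + k)) (Suc k) :: 'a::field_char_0 poly poly) =
    alpha ^ (s * Suc k) * embed (fibopoly s (m + k) (Suc k))
    + beta ^ (s * m) * embed (fibopoly s (m + k) k)"
proof -
  let ?N = "\<lambda>n k. \<Prod>i<k. bfib (s * (n - i)) :: 'a poly poly"
  let ?D = "\<lambda>k. \<Prod>i=1..k. bfib (i * s) :: 'a poly poly"
  let ?C = "\<lambda>n k. embed (fibopoly s n k :: 'a poly poly)"
  let ?d = "alpha - beta :: 'a poly poly"
  have C: "?C n k * embed (?D k) = embed (?N n k)" for n k
    unfolding embed_simps(5)[symmetric] fibopoly_mult_denominator ..
  have D: "embed (?D (Suc k)) = embed (bfib (s * Suc k)) * embed (?D k)"
    by (simp add: embed_simps mult.commute)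
  have N1: "embed (?N (Suc (m + k)) (Suc k)) = embed (bfib (s * Suc (m + k))) * embed (?N (m + k) k)"
    by (simp add: prod.lessThan_Suc_shift embed_simps del: prod.lessThan_Suc)
  have N2: "embed (?N (m + k) (Suc k)) = embed (bfib (s * m)) * embed (?N (m + k) k)"
    by (simp add: embed_simps mult.commute)
  have "?d * embed (bfib (s * Suc (m + k)))
      = alpha ^ (s * Suc k) * (?d * embed (bfib (s * m)))
      + beta ^ (s * m) * (?d * embed (bfib (s * Suc k)))"
    unfolding binet by (simp add: algebra_simps power_add)
  then have f: "?d * embed (bfib (s * Suc (m + k)))
      = ?d * (alpha ^ (s * Suc k) * embed (bfib (s * m))
      + beta ^ (s * m) * embed (bfib (s * Suc k)))"
    by (simp only: algebra_simps)
  have "embed (?D (Suc k)) \<noteq> 0"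
    using assms by (simp add: embed_eq_0_iff bfib_nonzero del: prod.cl_ivl_Suc)
  moreover have "?C (Suc (m + k)) (Suc k) * embed (?D (Suc k)) =
      (alpha ^ (s * Suc k) * ?C (m + k) (Suc k) + beta ^ (s * m) * ?C (m + k) k) * embed (?D (Suc k))"
    (is "?l = ?r")
  proof -
    have "?l = (alpha ^ (s * Suc k) * embed (bfib (s * m))
        + beta ^ (s * m) * embed (bfib (s * Suc k))) * embed (?N (m + k) k)"
      unfolding C N1 using f mult_left_cancel[OF alpha_neq_beta] by metis
    also have "\<dots> = alpha ^ (s * Suc k) * embed (?N (m + k) (Suc k))
        + beta ^ (s * m) * (embed (bfib (s * Suc k)) * embed (?N (m + k) k))"
      unfolding N2 by (simp only: algebra_simps)
    also have "\<dots> = ?r"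
      unfolding C[symmetric] D by (simp only: algebra_simps)
    finally show ?thesis .
  qed
  ultimately show ?thesis by (metis mult_right_cancel)
qed

text \<open>By the Pascal rule, multiplying the series for p+1 by its factor with j = p+1 yields the
  series for p at \<open>beta ^ s * z\<close>. That substitution turns the remaining factors for p
  into those for p+1.\<close>

lemma fibopoly_shifted_gf:
  assumes "s \<ge> 1"
  shows "Abs_fps (\<lambda>n. embed (fibopoly s (n + p) p :: 'a::field_char_0 poly poly)) *
    (\<Prod>j\<le>p. 1 - fps_const (alpha ^ (s * j) * beta ^ (s * (p - j))) * fps_X) = 1"
proof (induction p)
  case 0
  have "Abs_fps (\<lambda>n. 1 :: 'a poly poly) * (1 - fps_X) = 1"
    by (rule fps_ext) (simp add: right_diff_distrib)
  then show ?case by (simp add: fibopoly_0_right embed_simps)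
next
  case (Suc p)
  let ?H = "\<lambda>p. Abs_fps (\<lambda>n. embed (fibopoly s (n + p) p :: 'a poly poly))"
  let ?r = "\<lambda>p j. alpha ^ (s * j) * beta ^ (s * (p - j)) :: 'a poly poly"
  let ?c = "fps_const (beta ^ s :: 'a poly poly) * fps_X"
  have "?H (Suc p) * (1 - fps_const (?r (Suc p) (Suc p)) * fps_X) = ?H p oo ?c"
  proof (rule fps_ext)
    fix n
    show "(?H (Suc p) * (1 - fps_const (?r (Suc p) (Suc p)) * fps_X)) $ n = (?H p oo ?c) $ n"
    proof (cases n)
      case 0
      then show ?thesis
        using assms by (simp add: fps_compose_linear fibopoly_self embed_simps)
    next
      case (Suc m)
      have "(?H (Suc p) * (1 - fps_const (?r (Suc p) (Suc p)) * fps_X)) $ n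
          = (?H (Suc p) - fps_X * (fps_const (?r (Suc p) (Suc p)) * ?H (Suc p))) $ n"
        by (simp only: algebra_simps mult_1_left mult_1_right)
      also have "\<dots> = ?H (Suc p) $ n - alpha ^ (s * Suc p) * ?H (Suc p) $ (n - 1)"
        using Suc by simp
      also have "\<dots> = (?H p oo ?c) $ n"
        using embed_fibopoly_Suc_Suc[OF assms, of "Suc m" p, where 'a='a] Suc
        by (simp add: fps_compose_linear power_mult[symmetric])
      finally show ?thesis .
    qed
  qed
  moreover have "(\<Prod>j\<le>p. 1 - fps_const (?r p j) * fps_X) oo ?c
      = (\<Prod>j\<le>p. 1 - fps_const (?r (Suc p) j) * fps_X)"
  proof -
    have "(1 - fps_const (?r p j) * fps_X) oo ?c = 1 - fps_const (?r (Suc p) j) * fps_X"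
      if "j \<le> p" for j
    proof -
      have "(1 - fps_const (?r p j) * fps_X) oo ?c = 1 - fps_const (?r p j * beta ^ s) * fps_X"
        by (simp add: fps_compose_sub_distrib fps_compose_mult_distrib mult.assoc
            flip: fps_const_mult)
      also have "?r p j * beta ^ s = ?r (Suc p) j"
        using that by (simp add: Suc_diff_le power_add mult.assoc mult.commute)
      finally show ?thesis .
    qed
    then show ?thesis
      by (simp add: fps_compose_prod_distrib)
  qed
  ultimately have "?H (Suc p) * (\<Prod>j\<le>Suc p. 1 - fps_const (?r (Suc p) j) * fps_X)
      = (?H p oo ?c) * ((\<Prod>j\<le>p. 1 - fps_const (?r p j) * fps_X) oo ?c)"
    by (simp add: mult.assoc mult.commute mult.left_commute)
  also have "\<dots> = (?H p * (\<Prod>j\<le>p. 1 - fps_const (?r p j) * fps_X)) oo ?c"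
    by (simp add: fps_compose_mult_distrib)
  also have "\<dots> = 1"
    unfolding Suc.IH by simp
  finally show ?case .
qed

lemma fibopoly_gf:
  assumes "s \<ge> 1"
  shows "Abs_fps (\<lambda>n. embed (fibopoly s n p :: 'a::field_char_0 poly poly)) *
    (\<Prod>j\<le>p. 1 - fps_const (alpha ^ (s * j) * beta ^ (s * (p - j))) * fps_X) = fps_X ^ p"
proof -
  have "Abs_fps (\<lambda>n. embed (fibopoly s n p :: 'a poly poly))
      = fps_X ^ p * Abs_fps (\<lambda>n. embed (fibopoly s (n + p) p))"
    by (rule fps_ext) (simp add: fps_X_power_mult_nth fibopoly_eq_0 embed_simps)
  then show ?thesis
    by (simp only: mult.assoc fibopoly_shifted_gf[OF assms] mult_1_right)
qed

section \<open>Derivations\<close>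

text \<open>
  These derivations extend \<open>(\<alpha> - \<beta>) \<partial>/\<partial>x\<close> and \<open>(\<alpha> - \<beta>) y \<partial>/\<partial>y\<close> along \<open>embed\<close>. The factors
  are chosen such that both map \<open>\<alpha>\<close> and \<open>\<beta>\<close>, hence every monomial in them, to a polynomial
  multiple of itself.
\<close>

definition lift_x :: "'a::field poly poly \<Rightarrow> 'a poly poly" where
  "lift_x f = alpha * pderiv f + (alpha - beta) * partial_x f"

definition lift_y :: "'a::field poly poly \<Rightarrow> 'a poly poly" where
  "lift_y f = - (alpha * beta) * pderiv f"

lemma partial_x_add: "partial_x (f + g) = partial_x f + partial_x g"
  by (rule poly_eqI) (simp add: partial_x_def coeff_map_poly pderiv_add)

lemma partial_x_mult: "partial_x (f * g) = partial_x f * g + f * partial_x g"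
proof (rule poly_eqI)
  fix n
  have "pderiv (sum h A) = (\<Sum>i\<in>A. pderiv (h i))" for h :: "nat \<Rightarrow> 'a poly" and A
    by (induction A rule: infinite_finite_induct) (simp_all add: pderiv_add)
  then show "coeff (partial_x (f * g)) n = coeff (partial_x f * g + f * partial_x g) n"
    by (simp add: partial_x_def coeff_map_poly coeff_mult pderiv_mult sum.distrib)
      (simp add: mult.commute add.commute)
qed

lemma lift_x_add: "lift_x (f + g) = lift_x f + lift_x g"
  by (simp add: lift_x_def pderiv_add partial_x_add algebra_simps)

lemma lift_x_mult: "lift_x (f * g) = lift_x f * g + f * lift_x g"
  by (simp add: lift_x_def pderiv_mult partial_x_mult algebra_simps)

lemma lift_y_add: "lift_y (f + g) = lift_y f + lift_y g"
  by (simp add: lift_y_def pderiv_add algebra_simps)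

lemma lift_y_mult: "lift_y (f * g) = lift_y f * g + f * lift_y g"
  by (simp add: lift_y_def pderiv_mult algebra_simps)

text \<open>Differentiating alpha^2 = x alpha + y implicitly with y fixed gives d(alpha)/dx = alpha
  / (alpha - beta), and then d(beta)/dx = -beta / (alpha - beta) since alpha + beta = x.\<close>

lemma lift_x_alpha: "lift_x alpha = alpha"
  by (simp add: lift_x_def alpha_def partial_x_def map_poly_pCons pderiv_pCons)

lemma lift_x_beta: "lift_x beta = - beta"
  by (simp add: lift_x_def alpha_def beta_def partial_x_def map_poly_pCons pderiv_pCons
      pderiv_minus one_pCons)

text \<open>With x fixed, implicit differentiation gives d(alpha)/dy = 1 / (alpha - beta) =
  -d(beta)/dy, and y is -alpha beta.\<close>

lemma lift_y_alpha: "lift_y alpha = - beta * alpha"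
  by (simp add: lift_y_def alpha_def beta_def pderiv_pCons)

lemma lift_y_beta: "lift_y beta = alpha * beta"
  by (simp add: lift_y_def alpha_def beta_def pderiv_pCons)

lemma derivation_monomial:
  fixes D :: "'a::comm_ring_1 \<Rightarrow> 'a"
  assumes mult: "\<And>f g. D (f * g) = D f * g + f * D g"
    and a: "D a = u * a" and b: "D b = v * b"
  shows "D (a ^ i * b ^ j) = (of_nat i * u + of_nat j * v) * (a ^ i * b ^ j)"
proof -
  have "D 1 = 0" using mult[of 1 1] by simp
  then have "D (w ^ i) = of_nat i * z * w ^ i" if "D w = z * w" for w z i
    by (induction i) (simp_all add: mult that algebra_simps)
  from this[OF a] this[OF b] show ?thesis
    by (simp add: mult algebra_simps)
qed

lemma lift_x_embed: "lift_x (embed f) = (alpha - beta) * embed (partial_x f)"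
proof (induction f rule: pCons_induct)
  case 0
  show ?case by (simp add: lift_x_def partial_x_def embed_simps)
next
  case (pCons a f)
  have E: "embed (pCons a f) = [:a:] + (- (alpha * beta)) * embed f"
    for a :: "'a poly" and f
    by (simp add: embed_def pcompose_pCons)
  have a: "lift_x [:a:] = (alpha - beta) * [:pderiv a:]"
    by (simp add: lift_x_def partial_x_def map_poly_pCons pderiv_pCons)
  \<comment> \<open>The image of y must be a constant for \<open>lift_x\<close>: the factors 1 and
    -1 of \<open>alpha\<close> and \<open>beta\<close> cancel on their product.\<close>
  have "lift_x (- (alpha * beta) :: 'a poly poly) + lift_x (alpha * beta) = 0"
    unfolding lift_x_add[symmetric] by (simp add: lift_x_def partial_x_def)
  then have q: "lift_x (- (alpha * beta) :: 'a poly poly) = 0"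
    by (simp add: lift_x_mult lift_x_alpha lift_x_beta)
  have "lift_x (embed (pCons a f))
      = (alpha - beta) * ([:pderiv a:] + (- (alpha * beta)) * embed (partial_x f))"
    unfolding E lift_x_add lift_x_mult a q pCons.IH by (simp add: algebra_simps)
  also have "[:pderiv a:] + (- (alpha * beta)) * embed (partial_x f) = embed (partial_x (pCons a f))"
    unfolding partial_x_def by (simp add: map_poly_pCons E)
  finally show ?case .
qed

text \<open>The chain rule: as a polynomial in alpha, the image alpha^2 - x alpha of y has
  derivative 2 alpha - x = alpha - beta.\<close>

lemma lift_y_embed: "lift_y (embed f) = (alpha - beta) * embed (var_y * partial_y f)"
proof -
  have q: "pderiv (- (alpha * beta)) = alpha - (beta :: 'a poly poly)"
    by (simp add: alpha_def beta_def pderiv_mult pderiv_pCons pderiv_minus)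
  have "pderiv (embed f) = embed (partial_y f) * (alpha - beta)"
    unfolding embed_def partial_y_def pderiv_pcompose q ..
  then show ?thesis
    by (simp only: lift_y_def embed_simps embed_var_y mult_ac)
qed

section \<open>The convolution formulas\<close>

text \<open>Induction in steps of two removes the outermost pair. The indices
  \<open>k < (p + 1) div 2\<close> are those strictly below p/2, so even p leaves the middle term
  over.\<close>

lemma sum_atMost_pair_reflect:
  fixes f :: "nat \<Rightarrow> 'b::comm_monoid_add"
  shows "(\<Sum>j\<le>p. f j) = (\<Sum>k<(p + 1) div 2. f k + f (p - k)) + (if even p then f (p div 2) else 0)"
proof (induction p arbitrary: f rule: nat_induct2)
  case (step p)
  have "(\<Sum>j\<le>p + 2. f j) = f 0 + f (p + 2) + (\<Sum>j\<le>p. f (Suc j))"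
  proof -
    have "(\<Sum>j\<le>p + 2. f j) = (\<Sum>j\<le>Suc p. f j) + f (p + 2)"
      by simp
    also have "(\<Sum>j\<le>Suc p. f j) = f 0 + (\<Sum>j\<le>p. f (Suc j))"
      by (rule sum.atMost_Suc_shift)
    finally show ?thesis by (simp only: add_ac)
  qed
  also have "(\<Sum>j\<le>p. f (Suc j)) = (\<Sum>k<(p + 1) div 2. f (Suc k) + f (Suc (p - k)))
      + (if even p then f (Suc (p div 2)) else 0)"
    using step[of "\<lambda>j. f (Suc j)"] by simp
  also have "(\<Sum>k<(p + 1) div 2. f (Suc k) + f (Suc (p - k))) =
      (\<Sum>k<(p + 1) div 2. f (Suc k) + f (p + 2 - Suc k))"
    by (intro sum.cong refl) (auto simp: Suc_diff_le intro!: arg_cong[where f=f])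
  also have "f 0 + f (p + 2) + (\<dots> + (if even p then f (Suc (p div 2)) else 0)) =
    (\<Sum>k<Suc ((p + 1) div 2). f k + f (p + 2 - k)) + (if even p then f (Suc (p div 2)) else 0)"
    unfolding sum.lessThan_Suc_shift by (simp add: add_ac)
  finally show ?case by simp
qed simp_all

lemma fibopoly_partial_x:
  fixes s p n :: nat
  assumes "s \<ge> 1"
  shows "partial_x (fibopoly s n p :: 'a::field_char_0 poly poly)
    = of_nat s * ((\<lambda>n. fibopoly s n p) \<star>
        (\<lambda>n. \<Sum>k<(p + 1) div 2.
          of_nat (p - 2 * k) * (- var_y) ^ (s * k * n) * bfib (s * (p - 2 * k) * n))) n"
proof -
  let ?d = "alpha - beta :: 'a poly poly"
  let ?r = "\<lambda>j. alpha ^ (s * j) * beta ^ (s * (p - j)) :: 'a poly poly"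
  let ?c = "\<lambda>j. of_nat (s * j) * 1 + of_nat (s * (p - j)) * - 1 :: 'a poly poly"
  let ?R = "\<lambda>n. \<Sum>k<(p + 1) div 2.
    of_nat (p - 2 * k) * (- var_y) ^ (s * k * n) * bfib (s * (p - 2 * k) * n) :: 'a poly poly"
  let ?C = "\<lambda>n. embed (fibopoly s n p :: 'a poly poly)"
  have r: "lift_x (?r j) = ?c j * ?r j" for j
    by (rule derivation_monomial) (simp_all add: lift_x_mult lift_x_alpha lift_x_beta)
  have R: "(\<Sum>j\<le>p. ?c j * ?r j ^ m) = ?d * embed (of_nat s * ?R m)" for m
  proof -
    let ?f = "\<lambda>j. ?c j * ?r j ^ m"
    \<comment> \<open>The factor \<open>?c j\<close> = s(2j - p) changes sign under j -> p - j, and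
      (alpha beta)^{sk} is common to both monomials. What remains is a difference of powers, to
      which Binet's formula applies. At j = p/2 the factor is 0.\<close>
    have pair: "?f k + ?f (p - k) = of_nat s * (of_nat (p - 2 * k) * (alpha * beta) ^ (s * k * m)
        * (?d * embed (bfib (s * (p - 2 * k) * m))))" if "k < (p + 1) div 2" for k
    proof -
      from that have "p = (p - 2 * k) + 2 * k" by simp
      then obtain q where p: "p = q + 2 * k" by blast
      have e: "p - k = q + k" "p - (q + k) = k" "p - 2 * k = q"
        using p by simp_all
      show ?thesis
        unfolding binet e
        by (simp add: algebra_simps power_add power_mult_distrib flip: power_mult)
    qed
    have mid: "?f (p div 2) = 0" if "even p"
    proof -
      have "p - p div 2 = p div 2" using that by auto
      then show ?thesis by simp
    qed
    have "(\<Sum>j\<le>p. ?f j) = (\<Sum>k<(p + 1) div 2. ?f k + ?f (p - k))"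
      unfolding sum_atMost_pair_reflect[of ?f] using mid by simp
    also have "\<dots> = (\<Sum>k<(p + 1) div 2. of_nat s * (of_nat (p - 2 * k) * (alpha * beta) ^ (s * k * m)
        * (?d * embed (bfib (s * (p - 2 * k) * m)))))"
      by (rule sum.cong[OF refl], rule pair) simp
    also have "\<dots> = ?d * embed (of_nat s * ?R m)"
      unfolding embed_simps sum_distrib_left embed_power embed_of_nat embed_var_y minus_minus
      by (simp only: mult_ac)
    finally show ?thesis .
  qed
  have R0: "?R 0 = 0" by simp
  have "?d * embed (partial_x (fibopoly s n p)) = lift_x (?C n)"
    by (simp add: lift_x_embed)
  also have "\<dots> = (\<Sum>t<n. ?C t * (\<Sum>j\<le>p. ?c j * ?r j ^ (n - t)))"
    using derivation_fps_nth_of_mult_prod_eq_X_power[OF lift_x_add lift_x_mult r fibopoly_gf[OF assms], of n]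
    by simp
  also have "\<dots> = ?d * embed (of_nat s * (\<Sum>t<n. fibopoly s t p * ?R (n - t)))"
    unfolding R by (simp add: embed_simps sum_distrib_left mult_ac)
  \<comment> \<open>The convolution has one more term, t = n, which vanishes because
    \<open>bfib 0 = 0\<close>.\<close>
  also have "(\<Sum>t<n. fibopoly s t p * ?R (n - t)) = ((\<lambda>n. fibopoly s n p) \<star> ?R) n"
    unfolding convolution_def
    by (rule sum.mono_neutral_left) (auto simp: not_less)
  finally show ?thesis
    using mult_left_cancel[OF alpha_neq_beta] embed_eq_iff by blast
qed

text \<open>Multiplying the derivative by y and the bracket by p y clears all denominators, so the
  identity can be proved among polynomials and matches the derivation y d/dy behind
  \<open>lift_y\<close>.\<close>

lemma fibopoly_partial_y:
  fixes s p n :: nat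
  assumes "s \<ge> 1" and "p \<ge> 1"
  shows "var_y * partial_y (fibopoly s (Suc n) p :: 'a::field_char_0 poly poly)
    = of_nat s * ((\<lambda>n. fibopoly s n p) \<star>
        (\<lambda>n. (\<Sum>k<(p + 1) div 2. (- var_y) ^ (s * k * (n + 1)) *
            (of_nat p * var_y * bfib (s * (p - 2 * k) * (n + 1) - 1)
              + of_nat k * var_x * bfib (s * (p - 2 * k) * (n + 1))))
          + (if even p then of_nat (p div 2) * (- var_y) ^ (s * p div 2 * (n + 1)) else 0))) n"
proof -
  let ?d = "alpha - beta :: 'a poly poly"
  let ?r = "\<lambda>j. alpha ^ (s * j) * beta ^ (s * (p - j)) :: 'a poly poly"
  let ?c = "\<lambda>j. of_nat (s * j) * - beta + of_nat (s * (p - j)) * alpha :: 'a poly poly"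
  let ?T = "\<lambda>m k. (- var_y) ^ (s * k * m) * (of_nat p * var_y * bfib (s * (p - 2 * k) * m - 1)
    + of_nat k * var_x * bfib (s * (p - 2 * k) * m)) :: 'a poly poly"
  let ?M = "\<lambda>m. of_nat (p div 2) * (- var_y) ^ (s * p div 2 * m) :: 'a poly poly"
  let ?R = "\<lambda>m. (\<Sum>k<(p + 1) div 2. ?T m k) + (if even p then ?M m else 0)"
  let ?C = "\<lambda>n. embed (fibopoly s n p :: 'a poly poly)"
  have r: "lift_y (?r j) = ?c j * ?r j" for j
    by (rule derivation_monomial) (simp_all add: lift_y_mult lift_y_alpha lift_y_beta)
  have R: "(\<Sum>j\<le>p. ?c j * ?r j ^ m) = ?d * embed (of_nat s * ?R m)" if m: "m \<ge> 1" for m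
  proof -
    let ?f = "\<lambda>j. ?c j * ?r j ^ m"
    \<comment> \<open>With N = s(p-2k)m, the pair equals s (alpha beta)^{skm} times k (alpha +
      beta)(alpha^N - beta^N) - p alpha beta (alpha^{N-1} - beta^{N-1}); Binet's formula handles
      both differences.\<close>
    have pair: "?f k + ?f (p - k) = ?d * embed (of_nat s * ?T m k)" if "k < (p + 1) div 2" for k
    proof -
      from that have "p = (p - 2 * k) + 2 * k" "p - 2 * k \<ge> 1" by simp_all
      then obtain q where p: "p = q + 2 * k" and q: "q \<ge> 1" by blast
      have e: "p - k = q + k" "p - (q + k) = k" "p - 2 * k = q"
        using p by simp_all
      have np: "of_nat p = of_nat q + 2 * (of_nat k :: 'a poly poly)"
        unfolding p by simp
      \<comment> \<open>Here \<open>m \<ge> 1\<close> matters: the index N - 1 must be a true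
        predecessor, not a truncated 0.\<close>
      have "s * q * m \<noteq> 0" using assms q m by simp
      then obtain l where l: "s * q * m = Suc l" using not0_implies_Suc by blast
      have l': "m * (q * s) = Suc l" "m * (s * q) = Suc l" using l by (simp_all add: mult_ac)
      have "?d * embed (of_nat s * ?T m k) = of_nat s * ((alpha * beta) ^ (s * k * m) *
          (- (of_nat p * (alpha * beta) * (?d * embed (bfib l)))
            + of_nat k * (alpha + beta) * (?d * embed (bfib (Suc l)))))"
        unfolding e l
        by (simp add: embed_simps embed_power embed_of_nat embed_var_y embed_var_x algebra_simps)
      also have "\<dots> = ?f k + ?f (p - k)"
        unfolding binet e np
        by (simp add: algebra_simps power_add power_mult_distrib l' flip: power_mult)
      finally show ?thesis ..
    qed
    \<comment> \<open>Unlike for x, the middle factor is s(p/2)(alpha - beta), which is not 0; the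
      monomial is a power of alpha beta, that is, of -y.\<close>
    have mid: "?f (p div 2) = ?d * embed (of_nat s * ?M m)" if "even p"
    proof -
      from that obtain h where p: "p = 2 * h" by blast
      have e: "p div 2 = h" "p - h = h" "s * p div 2 = s * h" using p by simp_all
      show ?thesis unfolding e
        by (simp add: embed_simps embed_power embed_of_nat embed_var_y algebra_simps
            power_mult_distrib flip: power_mult)
    qed
    have "(\<Sum>j\<le>p. ?f j) = ?d * (embed (of_nat s * (\<Sum>k<(p + 1) div 2. ?T m k)))
        + (if even p then ?d * embed (of_nat s * ?M m) else 0)"
    proof -
      have "(\<Sum>k<(p + 1) div 2. ?f k + ?f (p - k)) = (\<Sum>k<(p + 1) div 2. ?d * embed (of_nat s * ?T m k))"
        by (rule sum.cong[OF refl], rule pair) simp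
      also have "\<dots> = ?d * embed (of_nat s * (\<Sum>k<(p + 1) div 2. ?T m k))"
        by (simp only: embed_simps sum_distrib_left)
      finally show ?thesis
        unfolding sum_atMost_pair_reflect[of ?f] using mid by (cases "even p") (simp_all only: if_True if_False)
    qed
    also have "\<dots> = ?d * embed (of_nat s * ?R m)"
      by (simp add: embed_simps(1,3,5) distrib_left)
    finally show ?thesis .
  qed
  have "?d * embed (var_y * partial_y (fibopoly s (Suc n) p)) = lift_y (?C (Suc n))"
    by (simp add: lift_y_embed)
  also have "\<dots> = (\<Sum>t<Suc n. ?C t * (\<Sum>j\<le>p. ?c j * ?r j ^ (Suc n - t)))"
    using derivation_fps_nth_of_mult_prod_eq_X_power[OF lift_y_add lift_y_mult r fibopoly_gf[OF assms(1)], of "Suc n"]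
    by (simp del: sum.lessThan_Suc)
  also have "\<dots> = (\<Sum>t<Suc n. ?d * embed (of_nat s * (fibopoly s t p * ?R (Suc n - t))))"
  proof (intro sum.cong refl)
    fix t assume "t \<in> {..<Suc n}"
    then have "1 \<le> Suc n - t" by auto
    from R[OF this] show "?C t * (\<Sum>j\<le>p. ?c j * ?r j ^ (Suc n - t)) =
        ?d * embed (of_nat s * (fibopoly s t p * ?R (Suc n - t)))"
      by (simp only: embed_simps(5) mult_ac)
  qed
  also have "\<dots> = ?d * embed (of_nat s * (\<Sum>t<Suc n. fibopoly s t p * ?R (Suc n - t)))"
    by (simp only: embed_simps(5,6) sum_distrib_left)
  \<comment> \<open>At upper index n+1 the terms t = 0..n all have \<open>Suc n - t \<ge> 1\<close>,
    so they form the convolution at n with the second sequence shifted by one.\<close>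
  also have "(\<Sum>t<Suc n. fibopoly s t p * ?R (Suc n - t)) =
      ((\<lambda>n. fibopoly s n p) \<star> (\<lambda>n. ?R (n + 1))) n"
    unfolding convolution_def by (intro sum.cong) (auto simp: Suc_diff_le)
  finally show ?thesis
    using mult_left_cancel[OF alpha_neq_beta] embed_eq_iff by blast
qed

section \<open>Passage to the fraction field, where the division by p y takes place\<close>

lemma to_fract_power: "to_fract (f ^ n) = to_fract f ^ n"
  by (induction n) simp_all

lemma to_fract_of_nat: "to_fract (of_nat n) = of_nat n"
  by (induction n) simp_all

theorem proposition18:
  fixes s p n :: nat
  assumes "s \<ge> 1" and "p \<ge> 1"
  shows "partial_x (fibopoly s n p :: 'a::field_char_0 poly poly)
    = of_nat s * ((\<lambda>n. fibopoly s n p) \<star>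
        (\<lambda>n. \<Sum>k=0..(p + 1) div 2 - 1.
          of_nat (p - 2 * k) * (- var_y) ^ (s * k * n) * bfib (s * (p - 2 * k) * n))) n
    \<and> to_fract (partial_y (fibopoly s (n + 1) p :: 'a poly poly))
    = of_nat (s * p) * ((\<lambda>n. to_fract (fibopoly s n p)) \<star>
        (\<lambda>n. (\<Sum>k=0..(p + 1) div 2 - 1.
            (- to_fract var_y) ^ (s * k * (n + 1)) *
            (to_fract (bfib (s * (p - 2 * k) * (n + 1) - 1))
              + (of_nat k * to_fract var_x) / (of_nat p * to_fract var_y)
                * to_fract (bfib (s * (p - 2 * k) * (n + 1)))))
          - (1 + (- 1) ^ p) / 4 * (- to_fract var_y) ^ (s * p div 2 * (n + 1) - 1))) n"
proof -
  let ?y = "to_fract var_y :: 'a poly poly fract"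
  let ?x = "to_fract var_x :: 'a poly poly fract"
  let ?F = "\<lambda>n. to_fract (bfib n) :: 'a poly poly fract"
  \<comment> \<open>Since \<open>p \<ge> 1\<close>, the upper limit does not truncate and the range
    is not empty.\<close>
  have I: "{0..(p + 1) div 2 - 1} = {..<(p + 1) div 2}"
    using assms by auto
  have y0: "?y \<noteq> 0" by (simp add: var_y_def)
  have nat0: "(of_nat k :: 'a poly poly fract) \<noteq> 0" if "k \<noteq> 0" for k
    unfolding to_fract_of_nat[symmetric] using that by simp
  have p0: "(of_nat p :: 'a poly poly fract) \<noteq> 0" using assms by (intro nat0) simp
  let ?S = "\<lambda>m. (\<Sum>k<(p + 1) div 2. (- ?y) ^ (s * k * m) * (?F (s * (p - 2 * k) * m - 1)
      + (of_nat k * ?x) / (of_nat p * ?y) * ?F (s * (p - 2 * k) * m)))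
      - (1 + (- 1) ^ p) / 4 * (- ?y) ^ (s * p div 2 * m - 1)"
  let ?R = "\<lambda>m. (\<Sum>k<(p + 1) div 2. (- var_y) ^ (s * k * m) *
            (of_nat p * var_y * bfib (s * (p - 2 * k) * m - 1)
              + of_nat k * var_x * bfib (s * (p - 2 * k) * m)))
          + (if even p then of_nat (p div 2) * (- var_y) ^ (s * p div 2 * m) else 0) :: 'a poly poly"
  have R: "to_fract (?R m) = ?y * (of_nat p * ?S m)" if "m \<ge> 1" for m
  proof -
    \<comment> \<open>For even p the coefficient (1 + 1)/4 is 1/2, and one factor -y completes the
      power; its exponent is positive as s, p, m are. For odd p the coefficient is 0, so the
      rounding in \<open>s * p div 2\<close> is harmless.\<close>
    have "to_fract (if even p then of_nat (p div 2) * (- var_y) ^ (s * p div 2 * m) else 0 :: 'a poly poly)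
        = - (?y * (of_nat p * ((1 + (- 1) ^ p) / 4 * (- ?y) ^ (s * p div 2 * m - 1))))"
    proof (cases "even p")
      case True
      then obtain h where p: "p = 2 * h" by blast
      then have "s * p div 2 * m \<noteq> 0" using assms that by simp
      then obtain l where l: "s * p div 2 * m = Suc l" using not0_implies_Suc by blast
      have four: "(4 :: 'a poly poly fract) \<noteq> 0" using nat0[of 4] by simp
      then have "of_nat p * (1 + 1) / (4 :: 'a poly poly fract) = of_nat h"
        unfolding p by (simp add: field_simps)
      then show ?thesis
        unfolding l using p four by (simp add: to_fract_of_nat to_fract_power algebra_simps)
    qed simp
    moreover have "to_fract (\<Sum>k<(p + 1) div 2. (- var_y) ^ (s * k * m) *
            (of_nat p * var_y * bfib (s * (p - 2 * k) * m - 1)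
              + of_nat k * var_x * bfib (s * (p - 2 * k) * m)) :: 'a poly poly)
      = ?y * (of_nat p * (\<Sum>k<(p + 1) div 2. (- ?y) ^ (s * k * m) * (?F (s * (p - 2 * k) * m - 1)
      + (of_nat k * ?x) / (of_nat p * ?y) * ?F (s * (p - 2 * k) * m))))"
      unfolding to_fract_sum sum_distrib_left using p0 y0
      by (intro sum.cong refl) (simp add: to_fract_of_nat to_fract_power field_simps)
    ultimately show ?thesis
      unfolding to_fract_add right_diff_distrib by (simp only: diff_conv_add_uminus)
  qed
  have "?y * to_fract (partial_y (fibopoly s (Suc n) p)) =
      to_fract (of_nat s * ((\<lambda>n. fibopoly s n p) \<star> (\<lambda>n. ?R (n + 1))) n)"
    unfolding to_fract_mult[symmetric] fibopoly_partial_y[OF assms] ..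
  also have "\<dots> = of_nat s * (\<Sum>t=0..n. to_fract (fibopoly s t p) * to_fract (?R (n - t + 1)))"
    unfolding convolution_def to_fract_mult to_fract_sum to_fract_of_nat ..
  also have "\<dots> = of_nat s * (\<Sum>t=0..n. to_fract (fibopoly s t p) * (?y * (of_nat p * ?S (n - t + 1))))"
    by (intro arg_cong2[where f="(*)"] sum.cong refl R) simp
  also have "\<dots> = ?y * (of_nat (s * p) * ((\<lambda>n. to_fract (fibopoly s n p)) \<star> (\<lambda>n. ?S (n + 1))) n)"
    unfolding convolution_def of_nat_mult sum_distrib_left
    by (intro sum.cong refl) (simp only: mult_ac)
  finally have "to_fract (partial_y (fibopoly s (Suc n) p))
      = of_nat (s * p) * ((\<lambda>n. to_fract (fibopoly s n p)) \<star> (\<lambda>n. ?S (n + 1))) n"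
    using y0 mult_left_cancel by blast
  then show ?thesis
    unfolding I using fibopoly_partial_x[OF assms(1), of n p] by simp
qed

end
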